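(* Let $\mathcal{Y}=\{0,1\}$. Assume $D(r)=r^{-\beta}$ where $\beta\in(0,1)$. Let $f$ be a ranking function. Assume also $p=\Pr[Y=1]>0$ and $\overline{y}^f(s)=\Pr[Y=1\mid\tilde f(X)=s]$ is a continuous function. Then, as $n\to\infty$, $$\mathrm{NDCG}_D(f,S_n)\overset{p}{\to}\frac{(1-\beta)\int_0^1\overline{y}^f(s)\cdot(1-s)^{-\beta}\,\mathrm{d}s}{p^{1-\beta}},$$ where $\overset{p}{\to}$ denotes convergence in probability.
   Context: $P_{XY}$ is a probability distribution on $\mathcal{X}\times\mathcal{Y}$ and $(X,Y)\sim P_{XY}$; $(x_1,y_1),(x_2,y_2),\ldots$ are i.i.d. from $P_{XY}$ and $S_n=\{(x_1,y_1),\ldots,(x_n,y_n)\}$. A ranking function is a map $f:\mathcal{X}\to\mathbb{R}$. It orders $x_1,\ldots,x_n$ by score, giving $x^f_{(1)},\ldots,x^f_{(n)}$ with $f(x^f_{(1)})\ge\cdots\ge f(x^f_{(n)})$; $y^f_{(r)}$ denotes the label of $x^f_{(r)}$. For a discount function $D$, $\mathrm{DCG}_D(f,S_n)=\sum_{r=1}^n y^f_{(r)}D(r)$; $\mathrm{IDCG}_D(S_n)=\max_{f'}\sum_{r=1}^n y^{f'}_{(r)}D(r)$ is the DCG of the best ranking of $S_n$; $\mathrm{NDCG}_D(f,S_n)=\mathrm{DCG}_D(f,S_n)/\mathrm{IDCG}_D(S_n)$. The canonical version of $f$ is $\tilde f(x)=\Pr_{X\sim P_X}[f(X)\le f(x)]$,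 where $P_X$ is the marginal of $X$.
   Formalization: The formal theorem also assumes that every s in [0,1] lies in the support of f̃(X), i.e. that f(X) has no atoms; otherwise (e.g. constant f) Pr[Y=1 | f̃(X)=s] is undefined on an interval and the integral is undetermined. *)

theory Defs
  imports "HOL-Probability.Probability"
begin

(* A sample is a sequence S of pairs (instance, label); S_n consists of S 1, ..., S n.
   A permutation \<pi> of {1..n} is an ordering of S_n by the score f if the item in position r is
   S (\<pi> r). When scores are tied there are several such \<pi>, and no rule for choosing among them
   is built in. *)

definition orders_by :: "('x \<Rightarrow> real) \<Rightarrow> nat \<Rightarrow> (nat \<Rightarrow> 'x \<times> real) \<Rightarrow> (nat \<Rightarrow> nat) \<Rightarrow> bool" where
  "orders_by f n S \<pi> \<longleftrightarrow>
     \<pi> permutes {1..n} \<and>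
     (\<forall>r\<in>{1..n}. \<forall>s\<in>{1..n}. r \<le> s \<longrightarrow> f (fst (S (\<pi> r))) \<ge> f (fst (S (\<pi> s))))"

definition dcg :: "(nat \<Rightarrow> real) \<Rightarrow> nat \<Rightarrow> (nat \<Rightarrow> 'x \<times> real) \<Rightarrow> (nat \<Rightarrow> nat) \<Rightarrow> real" where
  "dcg D n S \<pi> = (\<Sum>r=1..n. snd (S (\<pi> r)) * D r)"

(* f' ranges over all real functions on the type of instances, and \<pi> over all orderings by f'. *)

definition idcg :: "(nat \<Rightarrow> real) \<Rightarrow> nat \<Rightarrow> (nat \<Rightarrow> 'x \<times> real) \<Rightarrow> real" where
  "idcg D n S = Max {dcg D n S \<pi> | (f' :: 'x \<Rightarrow> real) \<pi>. orders_by f' n S \<pi>}"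

(* If idcg is 0 (for 0/1 labels and positive D: if all n labels are 0), the quotient is 0. *)

definition ndcg :: "(nat \<Rightarrow> real) \<Rightarrow> nat \<Rightarrow> (nat \<Rightarrow> 'x \<times> real) \<Rightarrow> (nat \<Rightarrow> nat) \<Rightarrow> real" where
  "ndcg D n S \<pi> = dcg D n S \<pi> / idcg D n S"

definition canonical :: "'x measure \<Rightarrow> ('x \<Rightarrow> real) \<Rightarrow> 'x \<Rightarrow> real" where
  "canonical PX f x = measure PX {x' \<in> space PX. f x' \<le> f x}"

(* \<eta> s = Pr[Y = 1 | g X = s] for s in [0,1], where (X, Y) has distribution P.

   The second conjunct says that \<eta> is a version of the conditional probability. It determines \<eta>
   only almost everywhere with respect to the distribution of g X, so it says nothing at points
   outside the support of g X. The first conjunct says that every s in [0,1] lies in that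
   support, so that conditioning on g X = s is meaningful there and a continuous \<eta> is determined
   on [0,1].

   For g = canonical (distr P MX fst) f, the first conjunct holds iff the distribution of f X has
   no atoms: an atom of mass m makes g X skip an open interval of length m. The conjunct
   cannot be dropped: for constant f, g X = 1 almost surely, so any continuous \<eta> with
   \<eta> 1 = Pr[Y = 1] would be admitted, whatever its integral over [0,1]. *)

definition label_prob_given ::
    "('x \<times> real) measure \<Rightarrow> ('x \<Rightarrow> real) \<Rightarrow> (real \<Rightarrow> real) \<Rightarrow> bool" where
  "label_prob_given P g \<eta> \<longleftrightarrow>
     (\<forall>s\<in>{0..1}. \<forall>\<epsilon>>0. measure P {z \<in> space P. \<bar>g (fst z) - s\<bar> < \<epsilon>} > 0) \<and>
     (AE z in P. real_cond_exp P (vimage_algebra (space P) (\<lambda>z. g (fst z)) borel)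
                   (indicator {z \<in> space P. snd z = 1}) z
                 = \<eta> (g (fst z)))"

(* Measurability is included because measure M is 0 on non-measurable sets. *)

definition tendsto_in_prob :: "'w measure \<Rightarrow> (nat \<Rightarrow> 'w \<Rightarrow> real) \<Rightarrow> real \<Rightarrow> bool" where
  "tendsto_in_prob M Z c \<longleftrightarrow>
     (\<forall>n. Z n \<in> borel_measurable M) \<and>
     (\<forall>\<epsilon>>0. (\<lambda>n. measure M {\<omega> \<in> space M. \<bar>Z n \<omega> - c\<bar> > \<epsilon>}) \<longlonglongrightarrow> 0)"

end

theory Submission
  imports Defs "HOL-Real_Asymp.Real_Asymp"
begin

text \<open>Write \<open>U\<close> for the canonical score. It has no atoms, hence is uniform on \<open>[0,1]\<close>, and the items
  with \<open>U > 1 - q\<close> always form an initial segment of the ordering, of length about \<open>q n\<close>. The strong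
  law of large numbers, applied at all rational \<open>q\<close>, therefore shows that almost surely the top
  \<open>t n\<close> positions contain about \<open>n G t\<close> ones, where \<open>G t = Pr[Y = 1, U > 1 - t]\<close>. By the layer-cake
  formula for \<open>r powr (- \<beta>)\<close> and dominated convergence, the DCG divided by \<open>n powr (1 - \<beta>)\<close>
  converges to \<open>\<integral> G (v powr (- 1 / \<beta>)) dv\<close> over \<open>v > 0\<close>, which by the same formula and conditioning on
  \<open>U\<close> is \<open>\<integral> \<eta> s (1 - s) powr (- \<beta>) ds\<close>. The ideal DCG is \<open>\<Sum>r\<le>m. r powr (- \<beta>)\<close>, with \<open>m \<sim> p n\<close> the
  number of ones.\<close>

subsection \<open>Sums with power weights\<close>

text \<open>Since \<open>x powr (- \<beta>)\<close> is strictly decreasing with inverse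
  \<open>v powr (- 1 / \<beta>)\<close>, a height in the layer-cake formula becomes a threshold on
  \<open>x\<close>. It is used with \<open>x = r / n\<close> for the weighted sums and with
  \<open>x = 1 - U z\<close> for the limiting integral.\<close>

lemma lt_powr_neg_iff:
  fixes x v \<beta> :: real
  assumes "x > 0" "v > 0" "\<beta> > 0"
  shows "v < x powr (- \<beta>) \<longleftrightarrow> x < v powr (- 1 / \<beta>)"
proof
  assume "v < x powr (- \<beta>)"
  then have "(x powr (- \<beta>)) powr (- 1 / \<beta>) < v powr (- 1 / \<beta>)"
    using assms by (intro powr_less_mono2_neg) auto
  then show "x < v powr (- 1 / \<beta>)"
    using assms by (simp add: powr_powr)
next
  assume "x < v powr (- 1 / \<beta>)"
  then have "(v powr (- 1 / \<beta>)) powr (- \<beta>) < x powr (- \<beta>)"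
    using assms by (intro powr_less_mono2_neg) auto
  then show "v < x powr (- \<beta>)"
    using assms by (simp add: powr_powr)
qed

text \<open>This is the dominating function for the integrals over heights. The exponent
  \<open>- 1 / \<beta>\<close> is below -1 exactly because \<beta> < 1, which gives the tail; the
  cap at 1 removes the singularity at 0.\<close>

lemma integrable_min_one_powr_neg:
  fixes \<beta> :: real
  assumes "0 < \<beta>" "\<beta> < 1"
  shows "integrable lborel (\<lambda>v. indicator {0<..} v * min 1 (v powr (- 1 / \<beta>)))"
proof -
  have e: "- 1 / \<beta> < -1" using assms by (simp add: field_simps)
  have "set_integrable lebesgue {1..} (\<lambda>v. v powr (- 1 / \<beta>))"
    using has_integral_powr_to_inf[OF e, of 1]
    by (intro nonnegative_absolutely_integrable_1) auto
  then have 1: "integrable lborel (\<lambda>v. indicator {1..} v * v powr (- 1 / \<beta>))"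
    unfolding set_integrable_def by (subst (asm) integrable_completion) auto
  have 2: "integrable lborel (indicator {0..1} :: real \<Rightarrow> real)"
    by simp
  show ?thesis
    by (rule Bochner_Integration.integrable_bound[OF Bochner_Integration.integrable_add[OF 1 2]])
      (auto simp: indicator_def)
qed

lemma card_less_le:
  fixes c :: real
  assumes "c \<ge> 0"
  shows "real (card {r\<in>{1..n}. real r < c}) \<le> min (real n) c"
proof -
  have "card {r\<in>{1..n}. real r < c} \<le> card {1..n}"
    by (rule card_mono) auto
  moreover have "card {r\<in>{1..n}. real r < c} \<le> card {1..nat \<lfloor>c\<rfloor>}"
    by (rule card_mono) (auto simp: le_nat_iff le_floor_iff)
  ultimately show ?thesis using assms by (simp add: of_nat_floor le_floor_iff) linarith
qed

text \<open>The layer-cake formula \<open>x powr (- \<beta>) = (\<integral>v. of_bool (0 < v \<and> v < x powr (- \<beta>)))\<close> turns the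
  weighted sum into an integral of counts of positions \<open>r < n v powr (- 1 / \<beta>)\<close>, to which
  dominated convergence applies.\<close>

lemma powr_weighted_sum_tendsto:
  fixes y :: "nat \<Rightarrow> nat \<Rightarrow> real" and G :: "real \<Rightarrow> real" and \<beta> :: real
  assumes \<beta>: "0 < \<beta>" "\<beta> < 1"
    and y: "\<And>n r. 1 \<le> r \<Longrightarrow> r \<le> n \<Longrightarrow> y n r \<in> {0..1}"
    and G: "\<And>t. t > 0 \<Longrightarrow> (\<lambda>n. (\<Sum>r | r \<in> {1..n} \<and> real r < t * real n. y n r) / real n) \<longlonglongrightarrow> G t"
    and [measurable]: "G \<in> borel_measurable borel"
  shows "(\<lambda>n. (\<Sum>r=1..n. y n r * real r powr (- \<beta>)) / real n powr (1 - \<beta>))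
           \<longlonglongrightarrow> (LBINT v. indicator {0<..} v * G (v powr (- 1 / \<beta>)))"
proof -
  \<comment> \<open>Positions are rescaled to \<open>r / n\<close>. The interval has length
    \<open>(r / n) powr (- \<beta>)\<close>, which contributes a factor
    \<open>n powr \<beta>\<close>; together with the division by \<open>n\<close> this makes the
    integral of \<open>s n\<close> the weighted sum over
    \<open>n powr (1 - \<beta>)\<close>.\<close>
  define s where "s n v = (\<Sum>r=1..n. y n r * indicator {0<..<(real r / real n) powr (- \<beta>)} v) / real n"
    for n and v :: real
  have s_eq: "s n v = (\<Sum>r | r \<in> {1..n} \<and> real r < v powr (- 1 / \<beta>) * real n. y n r) / real n"
    if "v > 0" for n v
  proof -
    have "(\<Sum>r=1..n. y n r * indicator {0<..<(real r / real n) powr (- \<beta>)} v) =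
          (\<Sum>r=1..n. if real r < v powr (- 1 / \<beta>) * real n then y n r else 0)"
    proof (rule sum.cong)
      fix r assume "r \<in> {1..n}"
      then have "v < (real r / real n) powr (- \<beta>) \<longleftrightarrow> real r < v powr (- 1 / \<beta>) * real n"
        using lt_powr_neg_iff[of "real r / real n" v \<beta>] \<open>v > 0\<close> \<beta> by (simp add: field_simps)
      then show "y n r * indicator {0<..<(real r / real n) powr (- \<beta>)} v =
          (if real r < v powr (- 1 / \<beta>) * real n then y n r else 0)"
        using \<open>v > 0\<close> by (simp add: indicator_def)
    qed simp
    also have "\<dots> = (\<Sum>r | r \<in> {1..n} \<and> real r < v powr (- 1 / \<beta>) * real n. y n r)"
      by (subst sum.inter_filter[symmetric]) auto
    finally show ?thesis by (simp add: s_def)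
  qed
  have s_neg: "s n v = 0" if "v \<le> 0" for n v
    using that by (simp add: s_def)
  have int_s: "integral\<^sup>L lborel (s n) = (\<Sum>r=1..n. y n r * real r powr (- \<beta>)) / real n powr (1 - \<beta>)"
    for n
  proof (cases "n = 0")
    case False
    have "integral\<^sup>L lborel (s n) = (\<Sum>r=1..n. y n r * (real r / real n) powr (- \<beta>)) / real n"
    proof -
      have "integral\<^sup>L lborel (s n) = (\<Sum>r=1..n.
          LBINT v. y n r * indicator {0<..<(real r / real n) powr (- \<beta>)} v) / real n"
        unfolding s_def integral_divide_zero
        by (subst Bochner_Integration.integral_sum) auto
      then show ?thesis by simp
    qed
    also have "\<dots> = (\<Sum>r=1..n. y n r * real r powr (- \<beta>)) * real n powr \<beta> / real n"
    proof -
      have scale: "(real r / real n) powr (- \<beta>) = real r powr (- \<beta>) * real n powr \<beta>" for r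
        by (simp add: powr_divide powr_minus_divide)
      show ?thesis
        unfolding scale by (simp only: sum_distrib_right mult.assoc)
    qed
    also have "\<dots> = (\<Sum>r=1..n. y n r * real r powr (- \<beta>)) / real n powr (1 - \<beta>)"
      using False by (simp add: powr_diff)
    finally show ?thesis .
  qed (simp add: s_def[abs_def])
  have "(\<lambda>n. integral\<^sup>L lborel (s n)) \<longlonglongrightarrow> (LBINT v. indicator {0<..} v * G (v powr (- 1 / \<beta>)))"
  proof (rule integral_dominated_convergence
      [where w = "\<lambda>v. indicator {0<..} v * min 1 (v powr (- 1 / \<beta>))"])
    show "(\<lambda>v. indicator {0<..} v * G (v powr (- 1 / \<beta>))) \<in> borel_measurable lborel"
      by measurable
    show "s n \<in> borel_measurable lborel" for n
      unfolding s_def by measurable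
    show "integrable lborel (\<lambda>v. indicator {0<..} v * min 1 (v powr (- 1 / \<beta>)))"
      by (rule integrable_min_one_powr_neg[OF \<beta>])
    show "AE v in lborel. (\<lambda>n. s n v) \<longlonglongrightarrow> indicator {0<..} v * G (v powr (- 1 / \<beta>))"
    proof (intro AE_I2)
      fix v :: real
      show "(\<lambda>n. s n v) \<longlonglongrightarrow> indicator {0<..} v * G (v powr (- 1 / \<beta>))"
        using G[of "v powr (- 1 / \<beta>)"] by (cases "v > 0") (auto simp: s_eq s_neg)
    qed
    \<comment> \<open>At height \<open>v > 0\<close>, \<open>s n v\<close> is at most the number of
      positions below \<open>v powr (- 1 / \<beta>) * n\<close>, divided by \<open>n\<close>. That
      number is bounded both by \<open>n\<close> and by the threshold itself.\<close>
    show "AE v in lborel. norm (s n v) \<le> indicator {0<..} v * min 1 (v powr (- 1 / \<beta>))" for n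
    proof (intro AE_I2)
      fix v :: real
      consider "v \<le> 0" | "n = 0" | "v > 0" "n > 0" by linarith
      then show "norm (s n v) \<le> indicator {0<..} v * min 1 (v powr (- 1 / \<beta>))"
      proof cases
        case 3
        define R where "R = {r\<in>{1..n}. real r < v powr (- 1 / \<beta>) * real n}"
        have "0 \<le> (\<Sum>r\<in>R. y n r)"
          by (rule sum_nonneg) (use y in \<open>auto simp: R_def\<close>)
        moreover have "(\<Sum>r\<in>R. y n r) \<le> real (card R) * 1"
          by (rule sum_bounded_above) (use y in \<open>auto simp: R_def\<close>)
        moreover have "real (card R) \<le> min (real n) (v powr (- 1 / \<beta>) * real n)"
          unfolding R_def by (rule card_less_le) simp
        moreover have "s n v = (\<Sum>r\<in>R. y n r) / real n"
          using 3 by (simp add: s_eq R_def)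
        ultimately have "0 \<le> s n v" "s n v \<le> 1" "s n v \<le> v powr (- 1 / \<beta>)"
          using 3 by (simp_all add: divide_le_eq)
        then show ?thesis
          using 3 by simp
      qed (auto simp: s_neg, auto simp: s_def)
    qed
  qed
  then show ?thesis by (simp add: int_s)
qed

text \<open>Discrete comparison with the integral of \<open>r powr (- \<beta>)\<close>: by the mean
  value theorem each increment of \<open>k powr (1 - \<beta>)\<close> lies between two consecutive
  terms of the sum multiplied by \<open>1 - \<beta>\<close>, and the increments telescope.\<close>

lemma sum_powr_neg_bounds:
  fixes \<beta> :: real
  assumes \<beta>: "0 < \<beta>" "\<beta> < 1"
  shows "(\<Sum>r=1..m. real r powr (- \<beta>)) * (1 - \<beta>) \<le> real m powr (1 - \<beta>)"
    and "real m powr (1 - \<beta>) - 1 \<le> (\<Sum>r=1..m. real r powr (- \<beta>)) * (1 - \<beta>)"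
proof -
  \<comment> \<open>The start \<open>k = 0\<close> is left out, as the derivative blows up at 0. In
    the upper bound the first term is covered by \<open>1 - \<beta> \<le> 1\<close>.\<close>
  have mvt: "(1 - \<beta>) * real (Suc k) powr (- \<beta>) \<le> real (Suc k) powr (1 - \<beta>) - real k powr (1 - \<beta>) \<and>
      real (Suc k) powr (1 - \<beta>) - real k powr (1 - \<beta>) \<le> (1 - \<beta>) * real k powr (- \<beta>)" if "k \<ge> 1" for k
  proof -
    have "\<exists>z. real k < z \<and> z < real (Suc k) \<and> real (Suc k) powr (1 - \<beta>) - real k powr (1 - \<beta>) =
        (real (Suc k) - real k) * ((1 - \<beta>) * z powr (1 - \<beta> - 1))"
      using that by (intro MVT2) (auto intro!: derivative_eq_intros)
    then obtain z where z: "real k < z" "z < real (Suc k)"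
      "real (Suc k) powr (1 - \<beta>) - real k powr (1 - \<beta>) = (1 - \<beta>) * z powr (- \<beta>)"
      by auto
    have "real (Suc k) powr (- \<beta>) \<le> z powr (- \<beta>)" "z powr (- \<beta>) \<le> real k powr (- \<beta>)"
      using z that \<beta> by (auto intro!: powr_mono2')
    then show ?thesis using z(3) \<beta> by (simp add: mult_left_mono)
  qed
  show "(\<Sum>r=1..m. real r powr (- \<beta>)) * (1 - \<beta>) \<le> real m powr (1 - \<beta>)"
  proof (induction m)
    case (Suc m)
    then show ?case
      using mvt[of m] \<beta> by (cases "m = 0") (auto simp: algebra_simps)
  qed simp
  \<comment> \<open>The term with index \<open>r\<close> dominates the increment from
    \<open>r\<close> to \<open>r + 1\<close>, so the telescoping sum runs from 1 to
    \<open>Suc m\<close>. This explains both the shifted endpoint and the subtracted 1.\<close>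
  have "real (Suc m) powr (1 - \<beta>) - 1 \<le> (\<Sum>r=1..m. real r powr (- \<beta>)) * (1 - \<beta>)"
  proof (induction m)
    case (Suc m)
    then show ?case
      using mvt[of "Suc m"] by (auto simp: algebra_simps)
  qed simp
  moreover have "real m powr (1 - \<beta>) \<le> real (Suc m) powr (1 - \<beta>)"
    using \<beta> by (intro powr_mono2) auto
  ultimately show "real m powr (1 - \<beta>) - 1 \<le> (\<Sum>r=1..m. real r powr (- \<beta>)) * (1 - \<beta>)"
    by linarith
qed

text \<open>After division by \<open>n powr (1 - \<beta>)\<close> the two bounds differ only by a
  vanishing term. With \<open>m n\<close> the number of ones among the first \<open>n\<close> labels
  this gives the growth of the ideal DCG.\<close>

lemma sum_powr_neg_tendsto:
  fixes \<beta> q :: real and m :: "nat \<Rightarrow> nat"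
  assumes \<beta>: "0 < \<beta>" "\<beta> < 1" and q: "q > 0"
    and m: "(\<lambda>n. real (m n) / real n) \<longlonglongrightarrow> q"
  shows "(\<lambda>n. (\<Sum>r=1..m n. real r powr (- \<beta>)) / real n powr (1 - \<beta>)) \<longlonglongrightarrow> q powr (1 - \<beta>) / (1 - \<beta>)"
proof -
  define H where "H n = (\<Sum>r=1..m n. real r powr (- \<beta>))" for n
  have b: "H n * (1 - \<beta>) \<le> real (m n) powr (1 - \<beta>)" "real (m n) powr (1 - \<beta>) - 1 \<le> H n * (1 - \<beta>)" for n
    unfolding H_def by (rule sum_powr_neg_bounds[OF \<beta>])+
  have 1: "(\<lambda>n. (real (m n) / real n) powr (1 - \<beta>)) \<longlonglongrightarrow> q powr (1 - \<beta>)"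
    using m q by (intro tendsto_intros) auto
  have "(\<lambda>n. 1 / real n powr (1 - \<beta>)) \<longlonglongrightarrow> 0"
    using \<beta> by real_asymp
  from tendsto_diff[OF 1 this]
  have 2: "(\<lambda>n. (real (m n) / real n) powr (1 - \<beta>) - 1 / real n powr (1 - \<beta>)) \<longlonglongrightarrow> q powr (1 - \<beta>)"
    by simp
  have "(\<lambda>n. H n * (1 - \<beta>) / real n powr (1 - \<beta>)) \<longlonglongrightarrow> q powr (1 - \<beta>)"
  proof (rule tendsto_sandwich[OF _ _ 2 1])
    show "\<forall>\<^sub>F n in sequentially. (real (m n) / real n) powr (1 - \<beta>) - 1 / real n powr (1 - \<beta>)
        \<le> H n * (1 - \<beta>) / real n powr (1 - \<beta>)"
      using eventually_gt_at_top[of 0]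
    proof eventually_elim
      case (elim n)
      show ?case using b(2)[of n] elim
        by (simp add: powr_divide divide_right_mono flip: diff_divide_distrib)
    qed
    show "\<forall>\<^sub>F n in sequentially. H n * (1 - \<beta>) / real n powr (1 - \<beta>) \<le> (real (m n) / real n) powr (1 - \<beta>)"
      by (intro always_eventually allI) (simp add: powr_divide divide_right_mono b(1))
  qed
  from tendsto_divide[OF this tendsto_const[of "1 - \<beta>"]] \<beta> show ?thesis
    by (simp add: H_def)
qed

subsection \<open>Orderings and the ideal DCG\<close>

text \<open>The largest element of a set of \<open>k\<close> positive positions is at least
  \<open>k\<close>, so its weight is at most \<open>D k\<close>; removing it allows
  induction.\<close>

lemma sum_le_sum_initial_segment:
  fixes D :: "nat \<Rightarrow> real"
  assumes "finite R" "R \<subseteq> {1..}"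
    and D: "\<And>r s. 1 \<le> r \<Longrightarrow> r \<le> s \<Longrightarrow> D s \<le> D r"
  shows "(\<Sum>r\<in>R. D r) \<le> (\<Sum>r=1..card R. D r)"
  using assms(1,2)
proof (induction R rule: finite_linorder_max_induct)
  case (insert b A)
  then have "b \<notin> A" by auto
  have "card (insert b A) \<le> card {1..b}"
    using insert.hyps insert.prems by (intro card_mono) (auto simp: subset_iff intro: less_imp_le)
  then have "Suc (card A) \<le> b"
    using insert.hyps \<open>b \<notin> A\<close> by simp
  then have "D b \<le> D (Suc (card A))"
    by (intro D) auto
  then show ?case
    using insert \<open>b \<notin> A\<close> by simp
qed simp

text \<open>Glues a bijection from the first \<open>card A\<close> positions onto \<open>A\<close>
  with one from the remaining positions onto the complement. With \<open>A\<close> the set of items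
  labelled 1, this is an ideal ordering.\<close>

lemma permutes_onto_subset:
  assumes "A \<subseteq> {1..n::nat}"
  obtains \<pi> where "\<pi> permutes {1..n}" "\<pi> ` {1..card A} = A"
proof -
  have finA: "finite A" using assms finite_subset by blast
  have m: "card A \<le> n" using card_mono[OF _ assms] by simp
  obtain f where f: "bij_betw f {1..card A} A"
    using finite_same_card_bij[of "{1..card A}" A] finA by auto
  have "card {Suc (card A)..n} = card ({1..n} - A)"
    using assms finA by (simp add: card_Diff_subset)
  then obtain g where g: "bij_betw g {Suc (card A)..n} ({1..n} - A)"
    using finite_same_card_bij[of "{Suc (card A)..n}" "{1..n} - A"] by auto
  define \<pi> where "\<pi> i = (if i \<in> {1..card A} then f i else if i \<in> {Suc (card A)..n} then g i else i)" for i
  have f': "bij_betw \<pi> {1..card A} A"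
    using f by (rule bij_betw_cong[THEN iffD1, rotated]) (simp add: \<pi>_def)
  have g': "bij_betw \<pi> {Suc (card A)..n} ({1..n} - A)"
    using g by (rule bij_betw_cong[THEN iffD1, rotated]) (simp add: \<pi>_def)
  have "bij_betw \<pi> ({1..card A} \<union> {Suc (card A)..n}) (A \<union> ({1..n} - A))"
    by (rule bij_betw_combine[OF f' g']) auto
  moreover have "{1..card A} \<union> {Suc (card A)..n} = {1..n}" "A \<union> ({1..n} - A) = {1..n}"
    using m assms by auto
  ultimately have "bij_betw \<pi> {1..n} {1..n}" by simp
  then have "\<pi> permutes {1..n}"
    by (rule bij_imp_permutes) (use m in \<open>auto simp: \<pi>_def\<close>)
  then show thesis using that bij_betw_imp_surj_on[OF f'] by blast
qed

lemma dcg_binary: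
  fixes S :: "nat \<Rightarrow> 'x \<times> real"
  assumes \<pi>: "\<pi> permutes {1..n}" and S: "\<And>i. i \<in> {1..n} \<Longrightarrow> snd (S i) \<in> {0, 1}"
  shows "dcg D n S \<pi> = (\<Sum>r | r \<in> {1..n} \<and> snd (S (\<pi> r)) = 1. D r)"
proof -
  have "dcg D n S \<pi> = (\<Sum>r\<in>{1..n}. if snd (S (\<pi> r)) = 1 then D r else 0)"
    unfolding dcg_def
  proof (rule sum.cong)
    fix r assume "r \<in> {1..n}"
    then have "\<pi> r \<in> {1..n}" by (simp only: permutes_in_image[OF \<pi>])
    from S[OF this] show "snd (S (\<pi> r)) * D r = (if snd (S (\<pi> r)) = 1 then D r else 0)"
      by auto
  qed simp
  also have "\<dots> = (\<Sum>r | r \<in> {1..n} \<and> snd (S (\<pi> r)) = 1. D r)"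
    by (subst sum.inter_filter[symmetric]) auto
  finally show ?thesis .
qed

text \<open>Under any permutation the ones occupy the same number of positions, so the weights they
  collect are at most those of an initial segment of that length. Placing all ones first attains
  this bound.\<close>

lemma idcg_binary:
  fixes S :: "nat \<Rightarrow> 'x \<times> real"
  assumes S: "\<And>i. i \<in> {1..n} \<Longrightarrow> snd (S i) \<in> {0, 1}"
    and D: "\<And>r s. 1 \<le> r \<Longrightarrow> r \<le> s \<Longrightarrow> D s \<le> D r"
  shows "idcg D n S = (\<Sum>r=1..card {i\<in>{1..n}. snd (S i) = 1}. D r)"
proof -
  define A where "A = {i\<in>{1..n}. snd (S i) = 1}"
  have card: "card {r \<in> {1..n}. snd (S (\<pi> r)) = 1} = card A" if \<pi>: "\<pi> permutes {1..n}" for \<pi>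
  proof -
    have "\<pi> ` {r \<in> {1..n}. snd (S (\<pi> r)) = 1} = A"
    proof
      show "\<pi> ` {r \<in> {1..n}. snd (S (\<pi> r)) = 1} \<subseteq> A"
        using permutes_in_image[OF \<pi>] by (auto simp: A_def simp del: atLeastAtMost_iff)
      show "A \<subseteq> \<pi> ` {r \<in> {1..n}. snd (S (\<pi> r)) = 1}"
      proof
        fix i assume i: "i \<in> A"
        then obtain r where "r \<in> {1..n}" "i = \<pi> r"
          using permutes_image[OF \<pi>] unfolding A_def by blast
        with i show "i \<in> \<pi> ` {r \<in> {1..n}. snd (S (\<pi> r)) = 1}" by (auto simp: A_def)
      qed
    qed
    moreover have "inj_on \<pi> {r \<in> {1..n}. snd (S (\<pi> r)) = 1}"
      using permutes_inj[OF \<pi>] by (rule inj_on_subset) simp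
    ultimately have "bij_betw \<pi> {r \<in> {1..n}. snd (S (\<pi> r)) = 1} A"
      by (simp add: bij_betw_def)
    then show ?thesis by (rule bij_betw_same_card)
  qed
  \<comment> \<open>A constant score ties all items, so every permutation is an ordering by it. The
    maximum over score functions is thus a maximum over all permutations, even if one instance
    occurs with different labels.\<close>
  have "orders_by (\<lambda>_. 0) n S \<pi>" if "\<pi> permutes {1..n}" for \<pi>
    using that by (simp add: orders_by_def)
  then have "{dcg D n S \<pi> | (f' :: 'x \<Rightarrow> real) \<pi>. orders_by f' n S \<pi>} = dcg D n S ` {\<pi>. \<pi> permutes {1..n}}"
    by (auto simp: orders_by_def)
  moreover have "Max (dcg D n S ` {\<pi>. \<pi> permutes {1..n}}) = (\<Sum>r=1..card A. D r)"
  proof (rule Max_eqI)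
    show "finite (dcg D n S ` {\<pi>. \<pi> permutes {1..n}})"
      by (intro finite_imageI finite_permutations) simp
    fix d assume "d \<in> dcg D n S ` {\<pi>. \<pi> permutes {1..n}}"
    then obtain \<pi> where \<pi>: "\<pi> permutes {1..n}" "d = dcg D n S \<pi>" by auto
    have "d = (\<Sum>r | r \<in> {1..n} \<and> snd (S (\<pi> r)) = 1. D r)"
      unfolding \<pi>(2) by (rule dcg_binary[OF \<pi>(1) S])
    also have "\<dots> \<le> (\<Sum>r=1..card {r \<in> {1..n}. snd (S (\<pi> r)) = 1}. D r)"
      by (rule sum_le_sum_initial_segment) (use D in auto)
    finally show "d \<le> (\<Sum>r=1..card A. D r)" using card[OF \<pi>(1)] by simp
  next
    obtain \<pi> where \<pi>: "\<pi> permutes {1..n}" "\<pi> ` {1..card A} = A"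
      by (rule permutes_onto_subset[of A n]) (auto simp: A_def)
    \<comment> \<open>The first \<open>card A\<close> positions all carry ones, and exactly
      \<open>card A\<close> positions do, so these are all of them.\<close>
    have "card A \<le> card {1..n}" by (rule card_mono) (auto simp: A_def)
    then have "{1..card A} \<subseteq> {r \<in> {1..n}. snd (S (\<pi> r)) = 1}"
      using \<pi>(2) by (auto simp: A_def)
    then have "{1..card A} = {r \<in> {1..n}. snd (S (\<pi> r)) = 1}"
      by (rule card_subset_eq[rotated]) (use card[OF \<pi>(1)] in auto)
    then have "(\<Sum>r=1..card A. D r) = dcg D n S \<pi>"
      using dcg_binary[OF \<pi>(1) S] by simp
    then show "(\<Sum>r=1..card A. D r) \<in> dcg D n S ` {\<pi>. \<pi> permutes {1..n}}"
      using \<pi>(1) by auto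
  qed
  ultimately show ?thesis by (simp add: idcg_def A_def)
qed

lemma downward_closed_eq_initial_segment:
  assumes "R \<subseteq> {1..n::nat}" and "\<And>r s. s \<in> R \<Longrightarrow> 1 \<le> r \<Longrightarrow> r \<le> s \<Longrightarrow> r \<in> R"
  shows "R = {1..card R}"
proof (cases "R = {}")
  case False
  have fin: "finite R" using assms(1) finite_subset by blast
  have "R = {1..Max R}"
    using assms fin Max_in[OF fin False] by (fastforce intro: Max_ge)
  moreover from this have "card R = Max R" by (metis card_atLeastAtMost diff_Suc_1)
  ultimately show ?thesis by simp
qed simp

text \<open>A function \<open>g\<close> that is monotone in the score takes values above a threshold exactly on an
  initial segment of the ordering, so ties in the score do not matter.\<close>

lemma sum_top_segment:
  fixes S :: "nat \<Rightarrow> 'x \<times> real" and g :: "'x \<Rightarrow> real"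
  assumes ord: "orders_by f n S \<pi>" and g: "\<And>a b. f a \<le> f b \<Longrightarrow> g a \<le> g b"
    and S: "\<And>i. i \<in> {1..n} \<Longrightarrow> snd (S i) \<in> {0, 1}"
  shows "(\<Sum>r=1..card {i\<in>{1..n}. g (fst (S i)) > u}. snd (S (\<pi> r))) =
         real (card {i\<in>{1..n}. snd (S i) = 1 \<and> g (fst (S i)) > u})"
proof -
  define R where "R = {r\<in>{1..n}. g (fst (S (\<pi> r))) > u}"
  define A where "A = {i\<in>{1..n}. g (fst (S i)) > u}"
  have \<pi>: "\<pi> permutes {1..n}" using ord by (simp add: orders_by_def)
  have bij: "bij_betw \<pi> R A"
    unfolding bij_betw_def
  proof
    show "inj_on \<pi> R" using permutes_inj[OF \<pi>] by (rule inj_on_subset) simp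
    show "\<pi> ` R = A"
    proof
      show "\<pi> ` R \<subseteq> A" using permutes_in_image[OF \<pi>] by (auto simp: R_def A_def simp del: atLeastAtMost_iff)
      show "A \<subseteq> \<pi> ` R"
      proof
        fix i assume i: "i \<in> A"
        then obtain r where "r \<in> {1..n}" "i = \<pi> r"
          using permutes_image[OF \<pi>] unfolding A_def by blast
        with i show "i \<in> \<pi> ` R" by (auto simp: R_def A_def)
      qed
    qed
  qed
  have "R = {1..card R}"
  proof (rule downward_closed_eq_initial_segment)
    fix r s assume *: "s \<in> R" "1 \<le> r" "r \<le> s"
    then have "f (fst (S (\<pi> s))) \<le> f (fst (S (\<pi> r)))"
      using ord by (auto simp: orders_by_def R_def)
    from g[OF this] * show "r \<in> R" by (auto simp: R_def)
  qed (auto simp: R_def)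
  then have "{1..card A} = R" using bij_betw_same_card[OF bij] by simp
  then have "(\<Sum>r=1..card A. snd (S (\<pi> r))) = (\<Sum>r\<in>R. snd (S (\<pi> r)))" by simp
  also have "\<dots> = (\<Sum>i\<in>A. snd (S i))"
    by (rule sum.reindex_bij_betw[OF bij])
  also have "\<dots> = (\<Sum>i\<in>A. if snd (S i) = 1 then 1 else 0)"
    by (rule sum.cong) (use S in \<open>force simp: A_def\<close>)+
  also have "\<dots> = real (card {i\<in>A. snd (S i) = 1})"
    by (subst sum.inter_filter[symmetric]) (auto simp: A_def)
  finally show ?thesis by (simp add: A_def conj_ac cong: conj_cong)
qed

text \<open>Passes from initial segments of data-dependent length \<open>N q n\<close>, controlled
  only for rational \<open>q\<close>, to the segment of positions below \<open>t * n\<close> for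
  every real \<open>t > 0\<close>. For \<open>q\<close> close to \<open>t\<close> the two lengths
  differ by a small multiple of \<open>n\<close>; as labels lie in [0,1], the partial sums differ by
  no more than the lengths, and the Lipschitz bound controls the change of the limit.\<close>

lemma scaled_partial_sum_tendsto:
  fixes y :: "nat \<Rightarrow> nat \<Rightarrow> real" and N :: "real \<Rightarrow> nat \<Rightarrow> nat" and G :: "real \<Rightarrow> real"
  assumes y: "\<And>n r. 1 \<le> r \<Longrightarrow> r \<le> n \<Longrightarrow> y n r \<in> {0..1}"
    and N_le: "\<And>q n. N q n \<le> n"
    and N: "\<And>q. q \<in> \<rat> \<Longrightarrow> q > 0 \<Longrightarrow> (\<lambda>n. real (N q n) / real n) \<longlonglongrightarrow> min q 1"
    and yN: "\<And>q. q \<in> \<rat> \<Longrightarrow> q > 0 \<Longrightarrow> (\<lambda>n. (\<Sum>r=1..N q n. y n r) / real n) \<longlonglongrightarrow> G q"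
    and G: "\<And>a b. 0 < a \<Longrightarrow> 0 < b \<Longrightarrow> \<bar>G a - G b\<bar> \<le> \<bar>a - b\<bar>"
    and t: "t > 0"
  shows "(\<lambda>n. (\<Sum>r | r \<in> {1..n} \<and> real r < t * real n. y n r) / real n) \<longlonglongrightarrow> G t"
proof (rule tendstoI)
  fix e :: real assume e: "e > 0"
  define c where "c n = card {r\<in>{1..n}. real r < t * real n}" for n
  have seg: "{r\<in>{1..n}. real r < t * real n} = {1..c n}" for n
    unfolding c_def by (rule downward_closed_eq_initial_segment) auto
  have c_le: "c n \<le> n" for n
    using card_mono[of "{1..n}" "{r\<in>{1..n}. real r < t * real n}"] unfolding c_def by force
  \<comment> \<open>If \<open>c n\<close> were smaller, \<open>Suc (c n)\<close> would still be an
    admissible position, although the admissible ones are exactly \<open>{1..c n}\<close>.\<close>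
  have c_lower: "min (t * real n) (real n) - 1 \<le> real (c n)" for n
  proof (rule ccontr)
    assume *: "\<not> ?thesis"
    then have "Suc (c n) \<in> {r\<in>{1..n}. real r < t * real n}" by auto
    then show False unfolding seg by simp
  qed
  have c_upper: "real (c n) \<le> t * real n" for n
  proof (cases "c n = 0")
    case False
    then have "c n \<in> {1..c n}" by simp
    then show ?thesis unfolding seg[symmetric] by simp
  qed (use t in simp)
  have c: "(\<lambda>n. real (c n) / real n) \<longlonglongrightarrow> min t 1"
  proof (rule tendsto_sandwich)
    show "\<forall>\<^sub>F n in sequentially. min t 1 - 1 / real n \<le> real (c n) / real n"
      using eventually_gt_at_top[of 0]
    proof eventually_elim
      case (elim n)
      have "min t 1 - 1 / real n = (min (t * real n) (real n) - 1) / real n"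
        using elim by (auto simp: min_def field_simps)
      also have "\<dots> \<le> real (c n) / real n"
        using c_lower by (rule divide_right_mono) simp
      finally show ?case .
    qed
    show "\<forall>\<^sub>F n in sequentially. real (c n) / real n \<le> min t 1"
      using eventually_gt_at_top[of 0]
    proof eventually_elim
      case (elim n)
      then show ?case using c_upper[of n] c_le[of n] by (auto simp: field_simps)
    qed
    show "(\<lambda>n. min t 1 - 1 / real n) \<longlonglongrightarrow> min t 1"
      using tendsto_diff[OF tendsto_const lim_1_over_n] by simp
  qed simp
  have diff: "\<bar>(\<Sum>r=1..a. y n r) - (\<Sum>r=1..b. y n r)\<bar> \<le> \<bar>real a - real b\<bar>"
    if "a \<le> n" "b \<le> n" for a b n
  proof -
    have *: "\<bar>(\<Sum>r=1..a. y n r) - (\<Sum>r=1..b. y n r)\<bar> \<le> real b - real a"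
      if "a \<le> b" "b \<le> n" for a b
    proof -
      have "(\<Sum>r=1..b. y n r) - (\<Sum>r=1..a. y n r) = (\<Sum>r\<in>{1..b} - {1..a}. y n r)"
        using that by (subst sum_diff) auto
      moreover have "0 \<le> (\<Sum>r\<in>{1..b} - {1..a}. y n r)"
        by (rule sum_nonneg) (use y that in auto)
      moreover have "(\<Sum>r\<in>{1..b} - {1..a}. y n r) \<le> real (card ({1..b} - {1..a})) * 1"
        by (rule sum_bounded_above) (use y that in auto)
      moreover have "card ({1..b} - {1..a}) = b - a"
        using that by (subst card_Diff_subset) auto
      ultimately show ?thesis using that by simp
    qed
    show ?thesis using *[of a b] *[of b a] that by linarith
  qed
  \<comment> \<open>Error budget: the normalised lengths differ in the limit by at most
    \<open>e / 8\<close>, hence eventually by less than \<open>e / 4\<close>. Convergence at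
    \<open>q\<close> and the passage from \<open>G q\<close> to \<open>G t\<close> cost
    \<open>e / 8\<close> each, for a total below \<open>e\<close>.\<close>
  obtain q where q: "q \<in> \<rat>" "t < q" "q < t + e / 8"
    using Rats_dense_in_real[of t "t + e / 8"] e by auto
  have "(\<lambda>n. real (c n) / real n - real (N q n) / real n) \<longlonglongrightarrow> min t 1 - min q 1"
    using q t by (intro tendsto_diff c N) auto
  then have "\<forall>\<^sub>F n in sequentially. dist (real (c n) / real n - real (N q n) / real n) (min t 1 - min q 1) < e / 8"
    by (rule tendstoD) (use e in simp)
  moreover have "\<forall>\<^sub>F n in sequentially. dist ((\<Sum>r=1..N q n. y n r) / real n) (G q) < e / 8"
    by (rule tendstoD[OF yN]) (use q t e in auto)
  ultimately show "\<forall>\<^sub>F n in sequentially.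
      dist ((\<Sum>r | r \<in> {1..n} \<and> real r < t * real n. y n r) / real n) (G t) < e"
    using eventually_gt_at_top[of 0]
  proof eventually_elim
    case (elim n)
    have "\<bar>((\<Sum>r=1..c n. y n r) - (\<Sum>r=1..N q n. y n r)) / real n\<bar>
        \<le> \<bar>(real (c n) - real (N q n)) / real n\<bar>"
      using divide_right_mono[OF diff[OF c_le[of n] N_le[of q n]], of "real n"]
      by (simp add: abs_divide)
    moreover have "\<bar>(real (c n) - real (N q n)) / real n\<bar> < e / 4"
    proof -
      define x where "x = (real (c n) - real (N q n)) / real n"
      define w where "w = min t 1 - min q 1"
      have "\<bar>w\<bar> \<le> e / 8" using q(2,3) unfolding w_def by (simp add: min_def)
      moreover have "\<bar>x - w\<bar> < e / 8"
        using elim(1) by (simp add: x_def w_def dist_real_def diff_divide_distrib)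
      ultimately have "\<bar>x\<bar> < e / 4" by linarith
      then show ?thesis by (simp add: x_def)
    qed
    ultimately have "\<bar>(\<Sum>r=1..c n. y n r) / real n - (\<Sum>r=1..N q n. y n r) / real n\<bar> < e / 4"
      by (simp only: diff_divide_distrib)
    moreover have "\<bar>G q - G t\<bar> \<le> e / 8" using G[of q t] q(2,3) t by linarith
    moreover have "\<bar>(\<Sum>r=1..N q n. y n r) / real n - G q\<bar> < e / 8"
      using elim(2) by (simp only: dist_real_def)
    ultimately have "\<bar>(\<Sum>r=1..c n. y n r) / real n - G t\<bar> < e"
      using e by linarith
    then show ?case unfolding seg dist_real_def .
  qed
qed

subsection \<open>Laws of large numbers\<close>

text \<open>For indicators Hoeffding's inequality bounds the deviation probabilities by
  \<open>2 * exp (- 2 * \<epsilon>\<^sup>2) ^ n\<close>. These are summable, so by Borel-Cantelli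
  almost surely only finitely many deviations exceed a given \<epsilon>.\<close>

lemma (in prob_space) AE_relative_frequency_tendsto:
  assumes indep: "indep_vars (\<lambda>_. N) X {1::nat..}"
    and distr: "\<And>i. i \<ge> 1 \<Longrightarrow> distr M N (X i) = N"
    and B: "B \<in> sets N"
  shows "AE \<omega> in M. (\<lambda>n. (\<Sum>i=1..n. indicator B (X i \<omega>) :: real) / real n)
           \<longlonglongrightarrow> measure N B"
proof -
  define Y where "Y i \<omega> = (indicator B (X i \<omega>) :: real)" for i \<omega>
  define avg where "avg n \<omega> = (\<Sum>i=1..n. Y i \<omega>) / real n" for n \<omega>
  define \<mu> where "\<mu> = measure N B"
  have X: "X i \<in> measurable M N" if "i \<ge> 1" for i
    using indep that unfolding indep_vars_def by auto
  have Y: "Y i \<in> borel_measurable M" if "i \<ge> 1" for i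
    unfolding Y_def using X[OF that] B by measurable
  have meas: "avg n \<in> borel_measurable M" for n
    unfolding avg_def by (intro borel_measurable_divide borel_measurable_sum Y) auto
  have indepY: "indep_vars (\<lambda>_. borel) Y {1::nat..}"
    unfolding Y_def using B by (intro indep_vars_compose2[OF indep]) simp
  have distrY: "distr M borel (Y i) = distr N borel (indicator B)" if "i \<ge> 1" for i
  proof -
    have "distr M borel (Y i) = distr (distr M N (X i)) borel (indicator B)"
      using X[OF that] B by (subst distr_distr) (auto simp: Y_def[abs_def] comp_def)
    then show ?thesis using distr[OF that] by simp
  qed
  have expY: "expectation (Y 1) = \<mu>"
  proof -
    have "expectation (Y 1) = integral\<^sup>L (distr M N (X 1)) (indicator B)"
      using X[of 1] B by (subst integral_distr) (auto simp: Y_def[abs_def])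
    then show ?thesis using distr[of 1] B sets.sets_into_space[OF B]
      by (simp add: \<mu>_def Int_absorb2 Int_absorb1)
  qed
  have bound: "prob {\<omega>\<in>space M. \<bar>avg n \<omega> - \<mu>\<bar> \<ge> \<epsilon>} \<le> 2 * exp (-2 * real n * \<epsilon>\<^sup>2)"
    if "\<epsilon> > 0" "n \<ge> 1" for \<epsilon> :: real and n :: nat
  proof -
    interpret Hoeffding_ineq_iid M "{1..n}" Y "Y 1" 0 1 \<mu>
    proof unfold_locales
      show "indep_vars (\<lambda>_. borel) Y {1..n}"
        by (rule indep_vars_subset[OF indepY]) auto
      show "AE x in M. Y 1 x \<in> {0..1}"
        by (auto simp: Y_def indicator_def)
    qed (use distrY expY Y in auto)
    show ?thesis
      using Hoeffding_ineq_abs_ge'[of \<epsilon>] that by (simp add: avg_def)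
  qed
  have ae: "AE \<omega> in M. eventually (\<lambda>n. \<bar>avg n \<omega> - \<mu>\<bar> < \<epsilon>) sequentially" if "\<epsilon> > 0" for \<epsilon>
  proof -
    define A where "A n = {\<omega>\<in>space M. \<bar>avg n \<omega> - \<mu>\<bar> \<ge> \<epsilon>}" for n
    have A: "A n \<in> sets M" for n
      unfolding A_def using meas[of n] by measurable
    have "summable (\<lambda>n. 2 * exp (-2 * \<epsilon>\<^sup>2) ^ n)"
      using that by (intro summable_mult summable_geometric) auto
    moreover have "norm (measure M (A n)) \<le> 2 * exp (-2 * \<epsilon>\<^sup>2) ^ n" if "n \<ge> 1" for n
      using bound[OF \<open>\<epsilon> > 0\<close> that] by (simp add: A_def mult_ac flip: exp_of_nat_mult)
    ultimately have "summable (\<lambda>n. measure M (A n))"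
      by (rule summable_comparison_test'[where N = 1])
    then have "AE \<omega> in M. eventually (\<lambda>n. \<omega> \<in> space M - A n) sequentially"
      using A by (intro borel_cantelli_AE1) (auto simp: emeasure_eq_measure)
    then show ?thesis
      by (rule AE_mp) (auto simp: A_def not_le elim!: eventually_mono intro!: AE_I2)
  qed
  \<comment> \<open>Restricting the tolerance to the countable family \<open>1 / Suc k\<close>
    allows a single null set to serve all of them.\<close>
  have "AE \<omega> in M. \<forall>k. eventually (\<lambda>n. \<bar>avg n \<omega> - \<mu>\<bar> < 1 / real (Suc k)) sequentially"
    unfolding AE_all_countable by (intro allI ae) simp
  then show ?thesis
  proof (rule AE_mp, intro AE_I2 impI)
    fix \<omega> assume *: "\<forall>k. eventually (\<lambda>n. \<bar>avg n \<omega> - \<mu>\<bar> < 1 / real (Suc k)) sequentially"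
    have "(\<lambda>n. avg n \<omega>) \<longlonglongrightarrow> \<mu>"
    proof (rule tendstoI)
      fix e :: real assume "e > 0"
      then obtain k where "1 / real (Suc k) < e"
        using nat_approx_posE by blast
      with * show "\<forall>\<^sub>F n in sequentially. dist (avg n \<omega>) \<mu> < e"
        by (auto simp: dist_real_def elim!: allE[of _ k] eventually_mono)
    qed
    then show "(\<lambda>n. (\<Sum>i=1..n. indicator B (X i \<omega>) :: real) / real n) \<longlonglongrightarrow> measure N B"
      by (simp add: avg_def Y_def \<mu>_def)
  qed
qed

text \<open>The indicators of the deviation events tend to 0 almost everywhere and are bounded by 1,
  so their integrals, the deviation probabilities, tend to 0 by dominated convergence.\<close>

lemma AE_tendsto_imp_tendsto_in_prob:
  assumes M: "prob_space M" and Z: "\<And>n. Z n \<in> borel_measurable M"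
    and lim: "AE \<omega> in M. (\<lambda>n. Z n \<omega>) \<longlonglongrightarrow> c"
  shows "tendsto_in_prob M Z c"
  unfolding tendsto_in_prob_def
proof (intro conjI allI impI Z)
  interpret prob_space M by fact
  fix \<epsilon> :: real assume "\<epsilon> > 0"
  define A where "A n = {\<omega> \<in> space M. \<bar>Z n \<omega> - c\<bar> > \<epsilon>}" for n
  have A: "A n \<in> sets M" for n unfolding A_def using Z[of n] by measurable
  have "(\<lambda>n. integral\<^sup>L M (indicator (A n) :: _ \<Rightarrow> real)) \<longlonglongrightarrow> integral\<^sup>L M (\<lambda>_. 0 :: real)"
  proof (rule integral_dominated_convergence[where w = "\<lambda>_. 1"])
    show "AE \<omega> in M. (\<lambda>n. indicator (A n) \<omega> :: real) \<longlonglongrightarrow> 0"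
      using lim
    proof (rule AE_mp, intro AE_I2 impI)
      fix \<omega> assume "(\<lambda>n. Z n \<omega>) \<longlonglongrightarrow> c"
      then have "eventually (\<lambda>n. dist (Z n \<omega>) c < \<epsilon>) sequentially"
        using \<open>\<epsilon> > 0\<close> by (rule tendstoD)
      then show "(\<lambda>n. indicator (A n) \<omega> :: real) \<longlonglongrightarrow> 0"
        by (intro tendsto_eventually)
          (auto simp: A_def dist_real_def indicator_def elim!: eventually_mono)
    qed
  qed (use A in \<open>auto simp: indicator_def\<close>)
  moreover have "integral\<^sup>L M (indicator (A n) :: _ \<Rightarrow> real) = measure M (A n)" for n
    using A[of n] sets.sets_into_space[OF A[of n]] by (simp add: Int_absorb1)
  ultimately show "(\<lambda>n. measure M {\<omega> \<in> space M. \<bar>Z n \<omega> - c\<bar> > \<epsilon>}) \<longlonglongrightarrow> 0"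
    by (simp add: A_def)
qed

subsection \<open>The canonical score\<close>

text \<open>Probability integral transform: for a continuous distribution function and
  \<open>s < 1\<close> the set is either empty, which forces \<open>s = 0\<close>, or a half-line
  \<open>{..a}\<close> with \<open>cdf M a = s\<close>. For \<open>s = 1\<close> it is the whole
  line.\<close>

lemma (in real_distribution) measure_cdf_le:
  assumes cont: "\<And>x. measure M {x} = 0" and s: "0 \<le> s" "s \<le> 1"
  shows "measure M {x. cdf M x \<le> s} = s"
proof (cases "s = 1")
  case True
  then show ?thesis using cdf_bounded_prob prob_space by simp
next
  case False
  then have s1: "s < 1" using s by simp
  have isCont: "isCont (cdf M) x" for x using cont isCont_cdf by simp
  show ?thesis
  proof (cases "\<exists>x. cdf M x \<le> s")
    case False
    have "s = 0"
    proof (rule ccontr)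
      assume "s \<noteq> 0"
      then have "eventually (\<lambda>x. cdf M x < s) at_bot"
        using order_tendstoD(2)[OF cdf_lim_at_bot] s by simp
      then obtain x where "cdf M x < s"
        using eventually_happens'[OF trivial_limit_at_bot_linorder] by blast
      then show False using False less_imp_le by blast
    qed
    with False show ?thesis by simp
  next
    case True
    have "eventually (\<lambda>x. s < cdf M x) at_top"
      using order_tendstoD(1)[OF cdf_lim_at_top_prob] s1 by simp
    then obtain B where B: "\<And>x. x \<ge> B \<Longrightarrow> s < cdf M x"
      by (auto simp: eventually_at_top_linorder)
    define a where "a = Sup {x. cdf M x \<le> s}"
    have bdd: "bdd_above {x. cdf M x \<le> s}"
      using B by (intro bdd_aboveI[of _ B]) (meson linorder_not_less mem_Collect_eq nle_le)
    have above: "s < cdf M x" if "x > a" for x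
      using cSup_upper[OF _ bdd, of x] that by (fastforce simp: a_def)
    \<comment> \<open>The supremum is attained because sublevel sets of a continuous function are
      closed. The reverse inequality comes from letting \<open>x\<close> decrease to
      \<open>a\<close>, where the values exceed \<open>s\<close>.\<close>
    have "a \<in> {x. cdf M x \<le> s}"
      unfolding a_def
    proof (rule closed_contains_Sup[OF _ bdd])
      show "closed {x. cdf M x \<le> s}"
        using isCont by (intro closed_Collect_le) (auto intro: continuous_at_imp_continuous_on)
    qed (use True in auto)
    then have "cdf M a \<le> s" by simp
    moreover have "s \<le> cdf M a"
    proof (rule tendsto_lowerbound)
      show "(cdf M \<longlongrightarrow> cdf M a) (at_right a)"
        using isCont[of a] by (simp add: isCont_def filterlim_at_split)
      show "eventually (\<lambda>x. s \<le> cdf M x) (at_right a)"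
        using eventually_at_right_less[of a] by eventually_elim (simp add: above less_imp_le)
    qed simp
    moreover have "{x. cdf M x \<le> s} = {..a}"
    proof
      show "{x. cdf M x \<le> s} \<subseteq> {..a}" using above by (auto simp: not_less[symmetric])
      show "{..a} \<subseteq> {x. cdf M x \<le> s}"
        using cdf_nondecreasing \<open>cdf M a \<le> s\<close> by (auto intro: order_trans)
    qed
    ultimately show ?thesis by (simp add: cdf_def)
  qed
qed

lemma canonical_eq_cdf:
  assumes X: "X \<in> measurable P MX" and f: "f \<in> borel_measurable MX"
  shows "canonical (distr P MX X) f x = cdf (distr P borel (\<lambda>z. f (X z))) (f x)"
proof -
  have "canonical (distr P MX X) f x = measure (distr (distr P MX X) borel f) {..f x}"
    using f by (subst measure_distr) (auto simp: canonical_def intro!: arg_cong2[where f = measure])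
  then show ?thesis
    using X f by (simp add: distr_distr cdf_def comp_def)
qed

text \<open>An atom of the score would make its distribution function jump, so that the canonical
  score would miss an interval inside [0,1], contrary to the full support. Without atoms the
  probability integral transform applies.\<close>

lemma (in prob_space) canonical_uniform:
  assumes X: "X \<in> measurable M MX" and f: "f \<in> borel_measurable MX"
    and supp: "\<And>s \<epsilon>. s \<in> {0..1} \<Longrightarrow> \<epsilon> > 0 \<Longrightarrow>
      measure M {z \<in> space M. \<bar>canonical (distr M MX X) f (X z) - s\<bar> < \<epsilon>} > 0"
  shows "distributed M lborel (\<lambda>z. canonical (distr M MX X) f (X z)) (indicator {0..1})"
proof -
  define Q where "Q = distr M borel (\<lambda>z. f (X z))"
  have fX [measurable]: "(\<lambda>z. f (X z)) \<in> borel_measurable M" using X f by measurable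
  interpret Q: real_distribution Q
    unfolding Q_def by (rule real_distribution_distr) (rule fX)
  have can: "canonical (distr M MX X) f x = cdf Q (f x)" for x
    unfolding Q_def by (rule canonical_eq_cdf[OF X f])
  have no_atom: "measure Q {a} = 0" for a
  proof (rule ccontr)
    assume "measure Q {a} \<noteq> 0"
    then have m: "measure Q {a} > 0" by (simp add: zero_less_measure_iff)
    \<comment> \<open>The midpoint of the jump: every value of the distribution function is at least
      half the atom's mass away from it.\<close>
    define s where "s = cdf Q a - measure Q {a} / 2"
    have jump: "cdf Q a = measure Q {..<a} + measure Q {a}"
    proof -
      have "{..a} = {..<a} \<union> {a}" by auto
      then show ?thesis
        using Q.finite_measure_Union[of "{..<a}" "{a}"] by (simp add: cdf_def)
    qed
    have far: "\<bar>cdf Q x - s\<bar> \<ge> measure Q {a} / 2" for x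
    proof (cases "x < a")
      case True
      then have "cdf Q x \<le> measure Q {..<a}"
        unfolding cdf_def by (intro Q.finite_measure_mono) auto
      then show ?thesis using jump unfolding s_def by linarith
    next
      case False
      then have "cdf Q a \<le> cdf Q x" by (intro Q.cdf_nondecreasing) simp
      then show ?thesis unfolding s_def by linarith
    qed
    have "s \<in> {0..1}"
      using jump m Q.cdf_bounded_prob[of a] by (simp add: s_def)
    from supp[OF this, of "measure Q {a} / 2"] m
    have "measure M {z \<in> space M. \<bar>cdf Q (f (X z)) - s\<bar> < measure Q {a} / 2} > 0"
      by (simp add: can)
    moreover have "{z \<in> space M. \<bar>cdf Q (f (X z)) - s\<bar> < measure Q {a} / 2} = {}"
      using far by (auto simp: not_less)
    ultimately show False by (metis less_irrefl measure_empty)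
  qed
  have [measurable]: "cdf Q \<in> borel_measurable borel"
    by (intro borel_measurable_mono monoI Q.cdf_nondecreasing)
  have U: "(\<lambda>z. cdf Q (f (X z))) \<in> borel_measurable M" by measurable
  have "distributed M lborel (\<lambda>z. cdf Q (f (X z))) (\<lambda>x. indicator {0..1} x / measure lborel {0..1::real})"
  proof (rule uniform_distrI_borel_atLeastAtMost[OF U])
    fix t :: real assume t: "0 \<le> t" "t \<le> 1"
    have "measure Q {x. cdf Q x \<le> t} = prob {z \<in> space M. cdf Q (f (X z)) \<le> t}"
      unfolding Q_def by (subst measure_distr) (auto simp flip: Q_def intro!: arg_cong2[where f = measure])
    then show "prob {z \<in> space M. cdf Q (f (X z)) \<le> t} = (t - 0) / (1 - 0)"
      using Q.measure_cdf_le[OF no_atom t] by simp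
  qed simp
  then show ?thesis by (simp add: can ennreal_indicator)
qed

lemma (in prob_space) prob_uniform_greater:
  fixes U :: "'a \<Rightarrow> real"
  assumes unif: "distributed M lborel U (indicator {0..1})" and t: "t > 0"
  shows "prob {z \<in> space M. U z > 1 - t} = min t 1"
proof -
  have [measurable]: "U \<in> borel_measurable M"
    using distributed_measurable[OF unif] by simp
  have "distributed M lborel U (\<lambda>x. indicator {0..1} x / measure lborel {0..1::real})"
    using unif by (simp add: ennreal_indicator[abs_def])
  from uniform_distributed_measure[OF this]
  have le: "prob {z \<in> space M. U z \<le> s} = s" if "0 \<le> s" "s \<le> 1" for s
    using that by simp
  have gt: "prob {z \<in> space M. U z > 1 - s} = s" if "0 < s" "s \<le> 1" for s
    using prob_neg[of "\<lambda>z. U z \<le> 1 - s"] le[of "1 - s"] that by (simp add: not_le)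
  show ?thesis
  proof (cases "t \<le> 1")
    case False
    then have "prob {z \<in> space M. U z > 1 - 1} \<le> prob {z \<in> space M. U z > 1 - t}"
      by (intro finite_measure_mono) auto
    moreover have "prob {z \<in> space M. U z > 1 - 1} = 1" by (rule gt) auto
    ultimately have "prob {z \<in> space M. U z > 1 - t} = 1"
      using prob_le_1[of "{z \<in> space M. U z > 1 - t}"] by linarith
    then show ?thesis using False by simp
  qed (use gt t in simp)
qed

lemma (in prob_space) uniform_AE_less_1:
  fixes U :: "'a \<Rightarrow> real"
  assumes unif: "distributed M lborel U (indicator {0..1})"
  shows "AE z in M. U z < 1"
proof -
  have "AE x in lborel. (0 :: ennreal) < indicator {0..1} x \<longrightarrow> x < (1::real)"
    using AE_lborel_singleton[of "1::real"] by eventually_elim (auto simp: indicator_def)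
  then have "AE x in density lborel (indicator {0..1::real}). x < 1"
    by (subst AE_density) auto
  then have "AE x in distr M lborel U. x < 1"
    by (simp only: distributed_distr_eq_density[OF unif])
  then show ?thesis
    using distributed_measurable[OF unif] by (subst (asm) AE_distr_iff) auto
qed

text \<open>Tonelli's theorem on the region \<open>0 < v < W z\<close>: integrating over
  \<open>v\<close> first returns \<open>W z\<close>, while integrating over \<open>z\<close> first
  gives the probability of a level set, which is a threshold event for \<open>U\<close>.\<close>

lemma (in prob_space) integral_layer_cake_powr:
  fixes U :: "'a \<Rightarrow> real" and \<beta> :: real
  assumes U [measurable]: "U \<in> borel_measurable M" and U1: "AE z in M. U z < 1"
    and A: "A \<in> sets M" and \<beta>: "\<beta> > 0"
  shows "(LBINT v. indicator {0<..} v * prob {z \<in> A. U z > 1 - v powr (- 1 / \<beta>)}) =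
    (\<integral>z. (1 - U z) powr (- \<beta>) * indicator A z \<partial>M)"
proof -
  define W where "W z = (1 - U z) powr (- \<beta>) * indicator A z" for z
  note A [measurable]
  have W [measurable]: "W \<in> borel_measurable M" unfolding W_def by measurable
  have sub: "{z \<in> A. P z} = {z \<in> space M. z \<in> A \<and> P z}" for P
    using sets.sets_into_space[OF A] by auto
  define H where "H v = indicator {0<..} v * prob {z \<in> A. U z > 1 - v powr (- 1 / \<beta>)}" for v
  interpret pair_sigma_finite M lborel ..
  \<comment> \<open>The level set and the threshold event agree only almost everywhere: at
    \<open>U z = 1\<close> the value \<open>0 powr (- \<beta>)\<close> is 0, while the threshold
    condition holds for every \<open>v > 0\<close>.\<close>
  have ev: "emeasure M {z \<in> space M. 0 < v \<and> v < W z} = ennreal (H v)" for v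
  proof (cases "v > 0")
    case True
    have "emeasure M {z \<in> space M. 0 < v \<and> v < W z} =
        emeasure M {z \<in> A. U z > 1 - v powr (- 1 / \<beta>)}"
    proof (rule emeasure_eq_AE)
      show "AE z in M. z \<in> {z \<in> space M. 0 < v \<and> v < W z} \<longleftrightarrow> z \<in> {z \<in> A. U z > 1 - v powr (- 1 / \<beta>)}"
        using U1 AE_space
      proof eventually_elim
        case (elim z)
        then show ?case
          using lt_powr_neg_iff[of "1 - U z" v \<beta>] True \<beta>
          by (auto simp: W_def indicator_def)
      qed
    qed (unfold sub, measurable)
    with True show ?thesis by (simp add: H_def emeasure_eq_measure)
  qed (simp add: H_def)
  have "(\<integral>\<^sup>+v. ennreal (H v) \<partial>lborel) =
      (\<integral>\<^sup>+v. \<integral>\<^sup>+z. indicator {z \<in> space M. 0 < v \<and> v < W z} z \<partial>M \<partial>lborel)"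
    by (simp flip: ev)
  also have "\<dots> = (\<integral>\<^sup>+v. \<integral>\<^sup>+z. (if 0 < v \<and> v < W z then 1 else 0) \<partial>M \<partial>lborel)"
    by (intro nn_integral_cong) (auto simp: indicator_def)
  also have "\<dots> = (\<integral>\<^sup>+z. \<integral>\<^sup>+v. (if 0 < v \<and> v < W z then 1 else 0) \<partial>lborel \<partial>M)"
    by (rule Fubini') measurable
  also have "\<dots> = (\<integral>\<^sup>+z. ennreal (W z) \<partial>M)"
  proof (intro nn_integral_cong)
    fix z
    have "(\<integral>\<^sup>+v. (if 0 < v \<and> v < W z then 1 else 0) \<partial>lborel) = (\<integral>\<^sup>+v. indicator {0<..<W z} v \<partial>lborel)"
      by (intro nn_integral_cong) (auto simp: indicator_def)
    also have "\<dots> = ennreal (W z)" by (simp add: W_def)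
    finally show "(\<integral>\<^sup>+v. (if 0 < v \<and> v < W z then 1 else 0) \<partial>lborel) = ennreal (W z)" .
  qed
  finally have eq: "(\<integral>\<^sup>+v. ennreal (H v) \<partial>lborel) = (\<integral>\<^sup>+z. ennreal (W z) \<partial>M)" .
  have H [measurable]: "H \<in> borel_measurable lborel"
  proof -
    have "(\<lambda>v. emeasure M {z \<in> space M. 0 < v \<and> v < W z}) \<in> borel_measurable lborel"
      by measurable
    then have "(\<lambda>v. enn2real (ennreal (H v))) \<in> borel_measurable lborel"
      unfolding ev by measurable
    then show ?thesis by (simp add: H_def[abs_def])
  qed
  have "integral\<^sup>L lborel H = integral\<^sup>L M W"
  proof -
    have "integral\<^sup>L lborel H = enn2real (\<integral>\<^sup>+v. ennreal (H v) \<partial>lborel)"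
      by (rule integral_eq_nn_integral) (rule H, simp add: H_def)
    also have "\<dots> = integral\<^sup>L M W"
      unfolding eq by (rule integral_eq_nn_integral[symmetric]) (auto simp: W_def)
    finally show ?thesis .
  qed
  then show ?thesis by (simp add: H_def[abs_def] W_def[abs_def])
qed

lemma (in prob_space) integral_powr_cond_prob:
  fixes U :: "'a \<Rightarrow> real" and \<eta> :: "real \<Rightarrow> real" and \<beta> :: real
  assumes U [measurable]: "U \<in> borel_measurable M"
    and unif: "distributed M lborel U (indicator {0..1})"
    and A [measurable]: "A \<in> sets M" and \<beta>: "0 < \<beta>" "\<beta> < 1"
    and \<eta>: "AE z in M. real_cond_exp M (vimage_algebra (space M) U borel) (indicator A) z = \<eta> (U z)"
    and cont: "continuous_on {0..1} \<eta>"
  shows "(\<integral>z. (1 - U z) powr (- \<beta>) * indicator A z \<partial>M) = (LBINT s:{0..1}. \<eta> s * (1 - s) powr (- \<beta>))"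
proof -
  define F where "F = vimage_algebra (space M) U borel"
  have unif': "distributed M lborel U (\<lambda>x. ennreal (indicator {0..1} x))"
    using unif by (simp add: ennreal_indicator[abs_def])
  have subalg: "subalgebra M F"
    using U by (auto simp: subalgebra_def F_def sets_vimage_algebra2 measurable_sets)
  interpret finite_measure_subalgebra M F
    by unfold_locales (rule subalg)
  have UF: "U \<in> borel_measurable F"
    unfolding F_def by (rule measurable_vimage_algebra1) simp
  \<comment> \<open>Continuity is given on [0,1] only. The cut-off makes the function Borel on the
    whole line and changes nothing almost surely, as \<open>U\<close> lies in [0,1].\<close>
  define \<eta>' where "\<eta>' s = indicator {0..1} s * \<eta> s" for s
  have \<eta>' [measurable]: "\<eta>' \<in> borel_measurable borel"
    using borel_measurable_continuous_on_indicator[OF _ cont] by (simp add: \<eta>'_def[abs_def])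
  have U01: "AE z in M. U z \<in> {0..1}"
  proof -
    have "AE x in lborel. (0 :: ennreal) < indicator {0..1} x \<longrightarrow> x \<in> {0..1::real}"
      by (auto simp: indicator_def)
    then have "AE x in density lborel (indicator {0..1::real}). x \<in> {0..1}"
      by (subst AE_density) auto
    then have "AE x in distr M lborel U. x \<in> {0..1}"
      by (simp only: distributed_distr_eq_density[OF unif])
    then show ?thesis by (subst (asm) AE_distr_iff) auto
  qed
  \<comment> \<open>The weight is unbounded near \<open>U = 1\<close>. Its integrability reduces,
    through uniformity and the reflection of \<open>x\<close> to \<open>1 - x\<close>, to that of
    \<open>x powr (- \<beta>)\<close> at 0, where \<beta> < 1 enters.\<close>
  have intU: "integrable M (\<lambda>z. (1 - U z) powr (- \<beta>))"
  proof -
    have "set_integrable lebesgue {0..1} (\<lambda>x. x powr (- \<beta>))"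
      using \<beta> by (intro nonnegative_absolutely_integrable_1 integrable_on_powr_from_0) auto
    then have "integrable lborel (\<lambda>x. indicator {0..1} x * x powr (- \<beta>))"
      unfolding set_integrable_def by (subst (asm) integrable_completion) auto
    then have "integrable lborel (\<lambda>x. indicator {0..1} (1 + (-1) * x) * (1 + (-1) * x) powr (- \<beta>))"
      by (subst lborel_integrable_real_affine_iff) auto
    also have "(\<lambda>x. indicator {0..1} (1 + (-1) * x) * (1 + (-1) * x) powr (- \<beta>)) =
        (\<lambda>x. indicator {0..1} x * (1 - x) powr (- \<beta>))"
      by (auto simp: indicator_def fun_eq_iff)
    finally show ?thesis
      by (subst distributed_integrable[OF unif', symmetric]) auto
  qed
  \<comment> \<open>The weight is measurable with respect to the sigma-algebra generated by
    \<open>U\<close>, so the indicator may be replaced by its conditional expectation.\<close>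
  have "(\<integral>z. (1 - U z) powr (- \<beta>) * indicator A z \<partial>M) =
      (\<integral>z. (1 - U z) powr (- \<beta>) * real_cond_exp M F (indicator A) z \<partial>M)"
    using UF by (intro real_cond_exp_intg(2)[symmetric] integrable_mult_indicator[OF A intU, simplified mult.commute[of "indicator _ _"] real_scaleR_def]) auto
  also have "\<dots> = (\<integral>z. (1 - U z) powr (- \<beta>) * \<eta>' (U z) \<partial>M)"
  proof (rule integral_cong_AE)
    show "AE z in M. (1 - U z) powr (- \<beta>) * real_cond_exp M F (indicator A) z = (1 - U z) powr (- \<beta>) * \<eta>' (U z)"
      using \<eta> U01 unfolding F_def[symmetric]
      by eventually_elim (simp add: \<eta>'_def)
  qed auto
  also have "\<dots> = (LBINT s. indicator {0..1} s * ((1 - s) powr (- \<beta>) * \<eta>' s))"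
    by (rule distributed_integral[OF unif', symmetric]) auto
  also have "\<dots> = (LBINT s:{0..1}. \<eta> s * (1 - s) powr (- \<beta>))"
    unfolding set_lebesgue_integral_def
    by (intro Bochner_Integration.integral_cong) (auto simp: \<eta>'_def indicator_def)
  finally show ?thesis .
qed

subsection \<open>Convergence of the NDCG\<close>

lemma ndcg_measurable:
  fixes S :: "nat \<Rightarrow> 'w \<Rightarrow> 'x \<times> real" and \<pi> :: "'w \<Rightarrow> nat \<Rightarrow> nat"
  assumes S [measurable]: "\<And>i. i \<in> {1..n} \<Longrightarrow> (\<lambda>\<omega>. snd (S i \<omega>)) \<in> borel_measurable M"
    and binary: "\<And>i \<omega>. i \<in> {1..n} \<Longrightarrow> \<omega> \<in> space M \<Longrightarrow> snd (S i \<omega>) \<in> {0, 1}"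
    and D: "\<And>r s. 1 \<le> r \<Longrightarrow> r \<le> s \<Longrightarrow> D s \<le> D r"
    and perm: "\<And>\<omega>. \<omega> \<in> space M \<Longrightarrow> \<pi> \<omega> permutes {1..n}"
    and \<pi> [measurable]: "\<And>r. (\<lambda>\<omega>. \<pi> \<omega> r) \<in> measurable M (count_space UNIV)"
  shows "(\<lambda>\<omega>. ndcg D n (\<lambda>i. S i \<omega>) (\<pi> \<omega>)) \<in> borel_measurable M"
proof -
  have dcg: "(\<lambda>\<omega>. dcg D n (\<lambda>i. S i \<omega>) (\<pi> \<omega>)) \<in> borel_measurable M"
  proof -
    \<comment> \<open>The index \<open>\<pi> \<omega> r\<close> is random. Splitting over its
      finitely many possible values turns the label at that position into a sum of measurable
      terms.\<close>
    have "dcg D n (\<lambda>i. S i \<omega>) (\<pi> \<omega>) =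
        (\<Sum>r=1..n. (\<Sum>i=1..n. if \<pi> \<omega> r = i then snd (S i \<omega>) else 0) * D r)" if "\<omega> \<in> space M" for \<omega>
      unfolding dcg_def
    proof (rule sum.cong)
      fix r assume "r \<in> {1..n}"
      then have "\<pi> \<omega> r \<in> {1..n}" by (simp only: permutes_in_image[OF perm[OF that]])
      then show "snd (S (\<pi> \<omega> r) \<omega>) * D r = (\<Sum>i=1..n. if \<pi> \<omega> r = i then snd (S i \<omega>) else 0) * D r"
        by (subst sum.delta') auto
    qed simp
    moreover have "(\<lambda>\<omega>. \<Sum>r=1..n. (\<Sum>i=1..n. if \<pi> \<omega> r = i then snd (S i \<omega>) else 0) * D r)
        \<in> borel_measurable M"
    proof (intro borel_measurable_sum borel_measurable_times measurable_If S borel_measurable_const)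
      show "{\<omega> \<in> space M. \<pi> \<omega> r = i} \<in> sets M" for r i
        using \<pi>[of r] by measurable
    qed
    ultimately show ?thesis by (subst measurable_cong)
  qed
  have card: "(\<lambda>\<omega>. card {i\<in>{1..n}. snd (S i \<omega>) = 1}) \<in> measurable M (count_space UNIV)"
  proof (rule measurable_card)
    fix i
    have "{\<omega> \<in> space M. snd (S i \<omega>) = 1} \<in> sets M" if "i \<in> {1..n}"
      using S[OF that] by measurable
    then show "{\<omega> \<in> space M. i \<in> {i\<in>{1..n}. snd (S i \<omega>) = 1}} \<in> sets M"
      by (cases "i \<in> {1..n}") (auto simp del: atLeastAtMost_iff)
  qed
  have "(\<lambda>\<omega>. \<Sum>r=1..card {i\<in>{1..n}. snd (S i \<omega>) = 1}. D r) \<in> borel_measurable M"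
    by (rule measurable_compose[OF card]) simp
  then have "(\<lambda>\<omega>. idcg D n (\<lambda>i. S i \<omega>)) \<in> borel_measurable M"
    by (subst measurable_cong[OF idcg_binary]) (use binary D in auto)
  with dcg show ?thesis unfolding ndcg_def by (rule borel_measurable_divide)
qed

text \<open>The deterministic core, for one fixed sample sequence: randomness enters only through
  limiting frequencies. The DCG and the ideal DCG are both divided by
  \<open>n powr (1 - \<beta>)\<close>, and the ideal one then tends to
  \<open>p powr (1 - \<beta>) / (1 - \<beta>)\<close>.\<close>

lemma ndcg_tendsto:
  fixes S :: "nat \<Rightarrow> 'x \<times> real" and g :: "'x \<Rightarrow> real" and \<beta> p :: real
  assumes \<beta>: "0 < \<beta>" "\<beta> < 1" and D: "\<And>r. r \<ge> 1 \<Longrightarrow> D r = real r powr (- \<beta>)"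
    and ord: "\<And>n. orders_by f n S (\<pi> n)" and g: "\<And>a b. f a \<le> f b \<Longrightarrow> g a \<le> g b"
    and S: "\<And>i. i \<ge> 1 \<Longrightarrow> snd (S i) \<in> {0, 1}"
    and p: "p > 0" "(\<lambda>n. real (card {i\<in>{1..n}. snd (S i) = 1}) / real n) \<longlonglongrightarrow> p"
    and freq: "\<And>q. q \<in> \<rat> \<Longrightarrow> q > 0 \<Longrightarrow>
      (\<lambda>n. real (card {i\<in>{1..n}. g (fst (S i)) > 1 - q}) / real n) \<longlonglongrightarrow> min q 1"
    and freq1: "\<And>q. q \<in> \<rat> \<Longrightarrow> q > 0 \<Longrightarrow>
      (\<lambda>n. real (card {i\<in>{1..n}. snd (S i) = 1 \<and> g (fst (S i)) > 1 - q}) / real n) \<longlonglongrightarrow> G q"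
    and G: "\<And>a b. 0 < a \<Longrightarrow> 0 < b \<Longrightarrow> \<bar>G a - G b\<bar> \<le> \<bar>a - b\<bar>" "G \<in> borel_measurable borel"
  shows "(\<lambda>n. ndcg D n S (\<pi> n)) \<longlonglongrightarrow>
    (1 - \<beta>) * (LBINT v. indicator {0<..} v * G (v powr (- 1 / \<beta>))) / p powr (1 - \<beta>)"
proof -
  define y where "y n r = snd (S (\<pi> n r))" for n r
  define L where "L = (LBINT v. indicator {0<..} v * G (v powr (- 1 / \<beta>)))"
  have y: "y n r \<in> {0..1}" if "1 \<le> r" "r \<le> n" for n r
  proof -
    have perm: "\<pi> n permutes {1..n}" using ord by (simp add: orders_by_def)
    have "r \<in> {1..n}" using that by simp
    then have "\<pi> n r \<in> {1..n}" by (simp only: permutes_in_image[OF perm])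
    then show ?thesis using S[of "\<pi> n r"] by (auto simp: y_def)
  qed
  define N where "N q n = card {i\<in>{1..n}. g (fst (S i)) > 1 - q}" for q n
  have N_le: "N q n \<le> n" for q n
    using card_mono[of "{1..n}" "{i\<in>{1..n}. g (fst (S i)) > 1 - q}"] unfolding N_def by force
  have yN: "(\<Sum>r=1..N q n. y n r) = real (card {i\<in>{1..n}. snd (S i) = 1 \<and> g (fst (S i)) > 1 - q})" for q n
    unfolding y_def N_def by (rule sum_top_segment[OF ord g]) (use S in auto)
  have "(\<lambda>n. (\<Sum>r | r \<in> {1..n} \<and> real r < t * real n. y n r) / real n) \<longlonglongrightarrow> G t" if "t > 0" for t
  proof (rule scaled_partial_sum_tendsto[where N = N, OF y N_le _ _ G(1) that])
    fix q :: real assume q: "q \<in> \<rat>" "q > 0"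
    show "(\<lambda>n. real (N q n) / real n) \<longlonglongrightarrow> min q 1"
      unfolding N_def by (rule freq[OF q])
    show "(\<lambda>n. (\<Sum>r=1..N q n. y n r) / real n) \<longlonglongrightarrow> G q"
      unfolding yN by (rule freq1[OF q])
  qed
  then have "(\<lambda>n. (\<Sum>r=1..n. y n r * real r powr (- \<beta>)) / real n powr (1 - \<beta>)) \<longlonglongrightarrow> L"
    unfolding L_def by (intro powr_weighted_sum_tendsto \<beta> y G)
  moreover have "dcg D n S (\<pi> n) = (\<Sum>r=1..n. y n r * real r powr (- \<beta>))" for n
    unfolding dcg_def y_def by (rule sum.cong) (auto simp: D)
  ultimately have dcg: "(\<lambda>n. dcg D n S (\<pi> n) / real n powr (1 - \<beta>)) \<longlonglongrightarrow> L"
    by simp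
  have D_mono: "D s \<le> D r" if "1 \<le> r" "r \<le> s" for r s
    using that \<beta> by (simp add: D powr_mono2')
  have "idcg D n S = (\<Sum>r=1..card {i\<in>{1..n}. snd (S i) = 1}. real r powr (- \<beta>))" for n
  proof -
    have "idcg D n S = (\<Sum>r=1..card {i\<in>{1..n}. snd (S i) = 1}. D r)"
      by (rule idcg_binary) (use S D_mono in auto)
    also have "\<dots> = (\<Sum>r=1..card {i\<in>{1..n}. snd (S i) = 1}. real r powr (- \<beta>))"
      by (rule sum.cong) (auto simp: D)
    finally show ?thesis .
  qed
  then have idcg: "(\<lambda>n. idcg D n S / real n powr (1 - \<beta>)) \<longlonglongrightarrow> p powr (1 - \<beta>) / (1 - \<beta>)"
    using sum_powr_neg_tendsto[OF \<beta> p] by simp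
  have "(\<lambda>n. (dcg D n S (\<pi> n) / real n powr (1 - \<beta>)) / (idcg D n S / real n powr (1 - \<beta>)))
      \<longlonglongrightarrow> L / (p powr (1 - \<beta>) / (1 - \<beta>))"
    by (rule tendsto_divide[OF dcg idcg]) (use p \<beta> in auto)
  moreover have "\<forall>\<^sub>F n in sequentially.
      (dcg D n S (\<pi> n) / real n powr (1 - \<beta>)) / (idcg D n S / real n powr (1 - \<beta>)) = ndcg D n S (\<pi> n)"
    using eventually_gt_at_top[of 0] by eventually_elim (simp add: ndcg_def)
  ultimately have "(\<lambda>n. ndcg D n S (\<pi> n)) \<longlonglongrightarrow> L / (p powr (1 - \<beta>) / (1 - \<beta>))"
    by (rule Lim_transform_eventually)
  then show ?thesis by (simp add: L_def mult.commute)
qed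

theorem theorem3:
  fixes M :: "'w measure" and MX :: "'x measure" and P :: "('x \<times> real) measure"
    and S :: "nat \<Rightarrow> 'w \<Rightarrow> 'x \<times> real"
    and f :: "'x \<Rightarrow> real" and \<pi> :: "nat \<Rightarrow> 'w \<Rightarrow> nat \<Rightarrow> nat"
    and D :: "nat \<Rightarrow> real" and \<beta> p :: real and \<eta> :: "real \<Rightarrow> real"
  assumes P: "prob_space P" "sets P = sets (MX \<Otimes>\<^sub>M count_space {0, 1})"
    and M: "prob_space M"
    and indep: "prob_space.indep_vars M (\<lambda>_. P) S {1..}"
    and distr: "\<And>i. i \<ge> 1 \<Longrightarrow> distr M P (S i) = P"
    and D: "\<And>r. r \<ge> 1 \<Longrightarrow> D r = real r powr (- \<beta>)"
    and \<beta>: "0 < \<beta>" "\<beta> < 1"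
    and f: "f \<in> borel_measurable MX"
    and orders: "\<And>n \<omega>. \<omega> \<in> space M \<Longrightarrow> orders_by f n (\<lambda>i. S i \<omega>) (\<pi> n \<omega>)"
    and orders_meas: "\<And>n r. (\<lambda>\<omega>. \<pi> n \<omega> r) \<in> measurable M (count_space UNIV)"
    and p: "p = measure P {z \<in> space P. snd z = 1}" "p > 0"
    and \<eta>: "label_prob_given P (canonical (distr P MX fst) f) \<eta>" "continuous_on {0..1} \<eta>"
  shows "tendsto_in_prob M (\<lambda>n \<omega>. ndcg D n (\<lambda>i. S i \<omega>) (\<pi> n \<omega>))
           ((1 - \<beta>) * (LBINT s:{0..1}. \<eta> s * (1 - s) powr (- \<beta>)) / p powr (1 - \<beta>))"
proof -
  interpret P: prob_space P by (rule P)
  interpret M: prob_space M by (rule M)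
  \<comment> \<open>The label space is {0,1} itself, so labels are binary at every sample point and
    not merely almost surely.\<close>
  have spaceP: "space P = space MX \<times> {0, 1}"
    using sets_eq_imp_space_eq[OF P(2)] by (simp add: space_pair_measure)
  have fst [measurable]: "fst \<in> measurable P MX"
    by (subst measurable_cong_sets[OF P(2) refl]) simp
  have "(\<lambda>z. snd z) \<in> borel_measurable (MX \<Otimes>\<^sub>M count_space {0, 1 :: real})"
    by (rule measurable_compose[OF measurable_snd]) simp
  then have snd [measurable]: "snd \<in> borel_measurable P"
    by (subst measurable_cong_sets[OF P(2) refl]) simp
  have S: "S i \<in> measurable M P" if "i \<ge> 1" for i
    using indep that unfolding M.indep_vars_def by auto
  define g where "g = canonical (distr P MX fst) f"
  define U where "U z = g (fst z)" for z :: "'x \<times> real"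
  define A where "A = {z \<in> space P. snd z = 1}"
  have unif: "distributed P lborel U (indicator {0..1})"
    unfolding U_def[abs_def] g_def
    by (rule P.canonical_uniform[OF fst f]) (use \<eta>(1) in \<open>auto simp: label_prob_given_def\<close>)
  then have U [measurable]: "U \<in> borel_measurable P"
    using distributed_measurable by fastforce
  have A [measurable]: "A \<in> sets P" unfolding A_def by measurable
  have g_mono: "g a \<le> g b" if "f a \<le> f b" for a b
  proof -
    interpret Q: real_distribution "distr P borel (\<lambda>z. f (fst z))"
      by (rule P.real_distribution_distr) (rule measurable_compose[OF fst f])
    show ?thesis
      unfolding g_def canonical_eq_cdf[OF fst f] by (rule Q.cdf_nondecreasing[OF that])
  qed
  define C where "C t = {z \<in> space P. U z > 1 - t}" for t
  define G where "G t = P.prob {z \<in> A. U z > 1 - t}" for t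
  have AC: "{z \<in> A. U z > 1 - t} = A \<inter> C t" for t
    by (auto simp: A_def C_def)
  have C [measurable]: "C t \<in> sets P" for t unfolding C_def by measurable
  have probC: "P.prob (C t) = min t 1" if "t > 0" for t
    unfolding C_def by (rule P.prob_uniform_greater[OF unif that])
  have G_mono: "G a \<le> G b" if "a \<le> b" for a b
    unfolding G_def AC using that by (intro P.finite_measure_mono) (auto simp: C_def)
  \<comment> \<open>\<open>A \<inter> C b\<close> is covered by \<open>A \<inter> C a\<close> and
    \<open>C b - C a\<close>, and by uniformity the latter has probability
    \<open>min b 1 - min a 1\<close>. This yields the Lipschitz constant 1.\<close>
  have G_diff: "G b - G a \<le> b - a" if "0 < a" "a \<le> b" for a b
  proof -
    have sub: "C a \<subseteq> C b" using that by (auto simp: C_def)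
    have "G b \<le> P.prob ((A \<inter> C a) \<union> (C b - C a))"
      unfolding G_def AC by (intro P.finite_measure_mono) auto
    also have "\<dots> \<le> P.prob (A \<inter> C a) + P.prob (C b - C a)"
      by (rule measure_Un_le) auto
    also have "P.prob (C b - C a) = min b 1 - min a 1"
      using that sub by (simp add: P.finite_measure_Diff probC)
    finally show ?thesis using that by (simp add: G_def AC)
  qed
  have G_lip: "\<bar>G a - G b\<bar> \<le> \<bar>a - b\<bar>" if "0 < a" "0 < b" for a b
    using G_mono[of a b] G_mono[of b a] G_diff[of a b] G_diff[of b a] that by (cases "a \<le> b") auto
  have G_meas: "G \<in> borel_measurable borel"
    by (intro borel_measurable_mono monoI G_mono)
  have L: "(LBINT v. indicator {0<..} v * G (v powr (- 1 / \<beta>))) = (LBINT s:{0..1}. \<eta> s * (1 - s) powr (- \<beta>))"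
  proof -
    have "AE z in P. U z < 1"
      by (rule P.uniform_AE_less_1[OF unif])
    then have "(LBINT v. indicator {0<..} v * G (v powr (- 1 / \<beta>))) =
        (\<integral>z. (1 - U z) powr (- \<beta>) * indicator A z \<partial>P)"
      unfolding G_def by (intro P.integral_layer_cake_powr) (use \<beta> in auto)
    also have "\<dots> = (LBINT s:{0..1}. \<eta> s * (1 - s) powr (- \<beta>))"
    proof (rule P.integral_powr_cond_prob[OF U unif A \<beta> _ \<eta>(2)])
      show "AE z in P. real_cond_exp P (vimage_algebra (space P) U borel) (indicator A) z = \<eta> (U z)"
        using \<eta>(1) by (simp add: label_prob_given_def g_def U_def[abs_def] A_def)
    qed
    finally show ?thesis .
  qed
  have freq: "AE \<omega> in M. (\<lambda>n. real (card {i\<in>{1..n}. S i \<omega> \<in> B}) / real n) \<longlonglongrightarrow> P.prob B"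
    if "B \<in> sets P" for B
  proof -
    have "(\<Sum>i=1..n. indicator B (S i \<omega>) :: real) = real (card {i\<in>{1..n}. S i \<omega> \<in> B})" for n \<omega>
      by (simp add: indicator_def sum.If_cases Int_def)
    then show ?thesis
      using M.AE_relative_frequency_tendsto[OF indep distr that] by simp
  qed
  \<comment> \<open>Each threshold has its own null set; as the rationals are countable, one null
    set suffices for all of them.\<close>
  have AE1: "AE \<omega> in M. \<forall>q\<in>\<rat>. (\<lambda>n. real (card {i\<in>{1..n}. S i \<omega> \<in> C q}) / real n) \<longlonglongrightarrow> P.prob (C q)"
    by (simp only: AE_ball_countable[OF countable_rat]) (intro ballI freq C)
  have AE2: "AE \<omega> in M. \<forall>q\<in>\<rat>. (\<lambda>n. real (card {i\<in>{1..n}. S i \<omega> \<in> A \<inter> C q}) / real n) \<longlonglongrightarrow> P.prob (A \<inter> C q)"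
    by (simp only: AE_ball_countable[OF countable_rat]) (intro ballI freq sets.Int A C)
  have AE3: "AE \<omega> in M. (\<lambda>n. real (card {i\<in>{1..n}. S i \<omega> \<in> A}) / real n) \<longlonglongrightarrow> p"
    using freq[OF A] by (simp add: p A_def)
  have D_mono: "D s \<le> D r" if "1 \<le> r" "r \<le> s" for r s
    using that \<beta> by (simp add: D powr_mono2')
  have S_space: "S i \<omega> \<in> space P" if "\<omega> \<in> space M" "i \<ge> 1" for i \<omega>
    using measurable_space[OF S] that by auto
  then have binary: "snd (S i \<omega>) \<in> {0, 1}" if "\<omega> \<in> space M" "i \<ge> 1" for i \<omega>
    using that spaceP by (metis mem_Sigma_iff prod.collapse)
  show ?thesis
  proof (rule AE_tendsto_imp_tendsto_in_prob[OF M])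
    show "(\<lambda>\<omega>. ndcg D n (\<lambda>i. S i \<omega>) (\<pi> n \<omega>)) \<in> borel_measurable M" for n
    proof (rule ndcg_measurable[OF _ _ D_mono])
      show "(\<lambda>\<omega>. snd (S i \<omega>)) \<in> borel_measurable M" if "i \<in> {1..n}" for i
        using measurable_compose[OF S snd] that by simp
    qed (use binary orders orders_meas in \<open>auto simp: orders_by_def\<close>)
    show "AE \<omega> in M. (\<lambda>n. ndcg D n (\<lambda>i. S i \<omega>) (\<pi> n \<omega>)) \<longlonglongrightarrow>
        (1 - \<beta>) * (LBINT s:{0..1}. \<eta> s * (1 - s) powr (- \<beta>)) / p powr (1 - \<beta>)"
      using AE1 AE2 AE3 AE_space
    proof eventually_elim
      case (elim \<omega>)
      have sets: "{i\<in>{1..n}. S i \<omega> \<in> C q} = {i\<in>{1..n}. g (fst (S i \<omega>)) > 1 - q}"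
        "{i\<in>{1..n}. S i \<omega> \<in> A \<inter> C q} = {i\<in>{1..n}. snd (S i \<omega>) = 1 \<and> g (fst (S i \<omega>)) > 1 - q}"
        "{i\<in>{1..n}. S i \<omega> \<in> A} = {i\<in>{1..n}. snd (S i \<omega>) = 1}" for n q
        using S_space[OF elim(4)] by (auto simp: A_def C_def U_def)
      show ?case
        unfolding L[symmetric]
      proof (rule ndcg_tendsto[OF \<beta> D orders[OF elim(4)] g_mono binary[OF elim(4)] p(2) _ _ _ G_lip G_meas])
        show "(\<lambda>n. real (card {i\<in>{1..n}. snd (S i \<omega>) = 1}) / real n) \<longlonglongrightarrow> p"
          using elim(3) unfolding sets .
        fix q :: real assume q: "q \<in> \<rat>" "q > 0"
        show "(\<lambda>n. real (card {i\<in>{1..n}. g (fst (S i \<omega>)) > 1 - q}) / real n) \<longlonglongrightarrow> min q 1"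
          using bspec[OF elim(1) q(1)] unfolding sets probC[OF q(2)] .
        show "(\<lambda>n. real (card {i\<in>{1..n}. snd (S i \<omega>) = 1 \<and> g (fst (S i \<omega>)) > 1 - q}) / real n) \<longlonglongrightarrow> G q"
          using bspec[OF elim(2) q(1)] unfolding sets G_def AC .
      qed
    qed
  qed
qed

end
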